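(* Let $f: \operatorname{int} \mathbb{R}^n_+ \to \operatorname{int} \mathbb{R}^n_+$ be order-preserving and homogeneous of degree one, and let $\rho = \rho(f)$ be the cone spectral radius of $f$. Then $f$ extends continuously to an order-preserving map (still denoted $f$) from $(0,\infty]^n$ to $(0,\infty]^n$, and there exist $z \in (0,\infty]^n$ having at least one finite entry and a real number $\tilde{\rho}$ with $0<\tilde\rho \le \rho$ such that $f(z) = \tilde{\rho} z$. In particular, if $x \in (0,\infty]^n$ and $x \le z$, then $f(x) \le \rho z$.
   Context: Let $n\ge 1$ and $\mathbb{R}^n_+ = \{x \in \mathbb{R}^n : x_i \ge 0 \text{ for all } i\}$, so $\operatorname{int}\mathbb{R}^n_+ = (0,\infty)^n$. The partial order on $\mathbb{R}^n$ and on $[0,\infty]^n$ is entrywise: $x \le y$ if and only if $x_i \le y_i$ for all $i \in \{1,\dots,n\}$. A map is order-preserving if $x \le y$ implies $f(x) \le f(y)$; $f$ is homogeneous of degree one on $\operatorname{int}\mathbb{R}^n_+$ if $f(\lambda x) = \lambda f(x)$ for all $\lambda > 0$ and $x \in \operatorname{int}\mathbb{R}^n_+$. The cone spectral radius is $\rho(f) = \lim_{k\to\infty} \|f^k(x)\|^{1/k}$ for any $x \in \operatorname{int}\mathbb{R}^n_+$, where $f^k$ is the $k$-th iterate; the limit exists, is positive and is independent of $x$. The set $(0,\infty]^n$ carries the product of the usual topologies on $(0,\infty] \subset [0,\infty]$, and multiplication by a real number $\lambda > 0$ is entrywise with $\lambda \cdot \infty = \infty$. *)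

theory Defs
  imports "HOL-Analysis.Analysis"
begin

definition nonneg_orthant :: "(real ^ 'n) set" where
  "nonneg_orthant = {x. \<forall>i. 0 \<le> x $ i}"

lemma interior_nonneg_orthant:
  "interior (nonneg_orthant :: (real ^ 'n) set) = {x. \<forall>i. 0 < x $ i}"
proof (rule interior_unique)
  have "{x. \<forall>i. 0 < x $ i} = (\<Inter>i. {x :: real ^ 'n. 0 < x $ i})"
    by auto
  moreover have "open (\<Inter>i. {x :: real ^ 'n. 0 < x $ i})"
    by (intro open_INT) (auto intro!: open_Collect_less continuous_intros)
  ultimately show "open {x :: real ^ 'n. \<forall>i. 0 < x $ i}"
    by simp
  show "T \<subseteq> {x. \<forall>i. 0 < x $ i}"
    if "T \<subseteq> nonneg_orthant" "open T" for T :: "(real ^ 'n) set"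
  proof -
    have "T \<subseteq> interior {x. 0 \<le> x $ i}" for i
      using that by (intro interior_maximal) (auto simp: nonneg_orthant_def)
    then show ?thesis by auto
  qed
qed (auto simp: nonneg_orthant_def less_imp_le)

definition ext_pos_orthant :: "(ennreal ^ 'n) set" where
  "ext_pos_orthant = {x. \<forall>i. 0 < x $ i}"

definition to_ext :: "real ^ 'n \<Rightarrow> ennreal ^ 'n" where
  "to_ext x = (\<chi> i. ennreal (x $ i))"

definition homogeneous_on :: "(real ^ 'n) set \<Rightarrow> (real ^ 'n \<Rightarrow> real ^ 'n) \<Rightarrow> bool" where
  "homogeneous_on C f \<longleftrightarrow> (\<forall>x\<in>C. \<forall>c>0. f (c *\<^sub>R x) = c *\<^sub>R f x)"

(* The description is proper for order-preserving homogeneous self-maps of the open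
   orthant: see cone_spectral_radius_wf and tendsto_cone_spectral_radius below. *)
definition cone_spectral_radius :: "(real ^ 'n \<Rightarrow> real ^ 'n) \<Rightarrow> real" where
  "cone_spectral_radius f =
     (THE r. \<forall>x\<in>interior nonneg_orthant. (\<lambda>k. root k (norm ((f ^^ k) x))) \<longlonglongrightarrow> r)"

lemma subadditive_quotient_tendsto:
  fixes b :: "nat \<Rightarrow> real"
  assumes sub: "\<And>k m. b (k + m) \<le> b k + b m"
    and lower: "\<And>k. l * real k \<le> b k"
  shows "\<exists>L. (\<lambda>k. b k / real k) \<longlonglongrightarrow> L"
proof -
  have mult: "b (q * m) \<le> real q * b m" if "q > 0" for q m
    using that
  proof (induction q rule: nat_induct_non_zero)
    case (Suc q)
    have "b (Suc q * m) \<le> b m + b (q * m)"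
      using sub[of m "q * m"] by simp
    with Suc show ?case by (simp add: algebra_simps)
  qed simp
  have bound: "\<exists>D. \<forall>k>0. b k / real k \<le> b m / real m + D / real k" if m: "m > 0" for m
  proof -
    define K where "K = (\<Sum>r<m. \<bar>b r\<bar>) + \<bar>b 0\<bar>"
    have "b k / real k \<le> b m / real m + (\<bar>b m\<bar> + K) / real k" if k: "k > 0" for k
    proof -
      define q r where "q = k div m" and "r = k mod m"
      have kqr: "k = q * m + r" and rm: "r < m"
        using m by (auto simp: q_def r_def)
      have "\<bar>b r\<bar> \<le> (\<Sum>r<m. \<bar>b r\<bar>)"
        by (rule member_le_sum) (use rm in auto)
      then have br: "b r \<le> (\<Sum>r<m. \<bar>b r\<bar>)" by linarith
      have "b (q * m) \<le> real q * b m + \<bar>b 0\<bar>"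
        using mult[of q m] by (cases "q = 0") auto
      then have 1: "b k \<le> real q * b m + K"
        using sub[of "q * m" r] br kqr by (simp add: K_def)
      have "real k * b m / real m = real q * b m + (real r / real m) * b m"
        using m kqr by (simp add: field_simps)
      moreover have "\<bar>(real r / real m) * b m\<bar> \<le> 1 * \<bar>b m\<bar>"
        unfolding abs_mult by (rule mult_right_mono) (use rm in auto)
      ultimately have "b k \<le> real k * b m / real m + \<bar>b m\<bar> + K"
        using 1 by linarith
      then have "b k / real k \<le> (real k * b m / real m + \<bar>b m\<bar> + K) / real k"
        by (rule divide_right_mono) simp
      also have "\<dots> = b m / real m + (\<bar>b m\<bar> + K) / real k"
        using k m by (simp add: field_simps)
      finally show ?thesis .
    qed
    then show ?thesis by blast
  qed
  define L where "L = Inf ((\<lambda>k. b k / real k) ` {0<..})"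
  have bdd: "bdd_below ((\<lambda>k. b k / real k) ` {0<..})"
    by (rule bdd_belowI2[of _ l]) (use lower in \<open>auto simp: field_simps\<close>)
  have "(\<lambda>k. b k / real k) \<longlonglongrightarrow> L"
  proof (rule LIMSEQ_I)
    fix e :: real assume e: "e > 0"
    have "\<exists>v\<in>(\<lambda>k. b k / real k) ` {0<..}. v < L + e / 2"
      by (rule cInf_lessD[OF _ , of _ "L + e / 2", simplified Bex_def[symmetric]])
        (use e in \<open>auto simp: L_def\<close>)
    then obtain m where m: "m > 0" "b m / real m < L + e / 2" by auto
    obtain D where D: "\<And>k. k > 0 \<Longrightarrow> b k / real k \<le> b m / real m + D / real k"
      using bound[OF m(1)] by blast
    have "(\<lambda>k. D / real k) \<longlonglongrightarrow> 0" by (rule lim_const_over_n)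
    then have "\<forall>\<^sub>F k in sequentially. D / real k < e / 2"
      by (rule order_tendstoD(2)) (use e in simp)
    then obtain N where N: "\<And>k. k \<ge> N \<Longrightarrow> D / real k < e / 2"
      by (auto simp: eventually_sequentially)
    have "norm (b k / real k - L) < e" if "k \<ge> Suc N" for k
    proof -
      have "L \<le> b k / real k"
        unfolding L_def by (rule cInf_lower[OF _ bdd]) (use that in auto)
      moreover have "b k / real k < L + e"
      proof -
        have "b k / real k \<le> b m / real m + D / real k" "D / real k < e / 2"
          using D[of k] N[of k] that by auto
        with m(2) show ?thesis by linarith
      qed
      ultimately show ?thesis by simp
    qed
    then show "\<exists>N. \<forall>k\<ge>N. norm (b k / real k - L) < e" by blast
  qed
  then show ?thesis by blast
qed

lemma cone_spectral_radius_wf: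
  fixes f :: "real ^ 'n \<Rightarrow> real ^ 'n"
  assumes maps: "f \<in> interior nonneg_orthant \<rightarrow> interior nonneg_orthant"
    and mono: "mono_on (interior nonneg_orthant) f"
    and hom: "homogeneous_on (interior nonneg_orthant) f"
  shows "\<exists>r>0. \<forall>x\<in>interior nonneg_orthant. (\<lambda>k. root k (norm ((f ^^ k) x))) \<longlonglongrightarrow> r"
proof -
  define P where "P = (interior nonneg_orthant :: (real ^ 'n) set)"
  have P: "x \<in> P \<longleftrightarrow> (\<forall>i. 0 < x $ i)" for x
    by (simp add: P_def interior_nonneg_orthant)
  have Pf: "f x \<in> P" if "x \<in> P" for x
    using maps that by (auto simp: P_def)
  have Pk: "(f ^^ k) x \<in> P" if "x \<in> P" for x k
    using that by (induction k) (auto intro: Pf)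
  have monok: "(f ^^ k) x \<le> (f ^^ k) y" if "x \<in> P" "y \<in> P" "x \<le> y" for x y k
    using that
    by (induction k) (auto intro!: mono_onD[OF mono[folded P_def]] Pk)
  have Ps: "c *\<^sub>R x \<in> P" if "x \<in> P" "c > 0" for x c
    using that by (auto simp: P)
  have homk: "(f ^^ k) (c *\<^sub>R x) = c *\<^sub>R (f ^^ k) x" if "x \<in> P" "c > 0" for x c k
    using that hom[folded P_def] by (induction k) (auto simp: homogeneous_on_def Pk)
  define e :: "real ^ 'n" where "e = (\<chi> i. 1)"
  have eP: "e \<in> P" by (simp add: P e_def)
  have normle: "norm x \<le> norm y" if "x \<in> P" "x \<le> y" for x y
    using that by (intro norm_le_componentwise_cart)
      (auto simp: P less_eq_vec_def abs_of_pos intro: order_trans[OF _ abs_ge_self])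
  have upper: "x \<le> norm x *\<^sub>R e" for x :: "real ^ 'n"
    using component_le_norm_cart[of x] by (auto simp: less_eq_vec_def e_def intro: abs_le_D1)
  have normpos: "norm x > 0" if "x \<in> P" for x
    using that by (auto simp: P)
  have lower: "\<exists>c>0. c *\<^sub>R e \<le> x" if "x \<in> P" for x
  proof -
    have "Min (range (\<lambda>i. x $ i)) > 0"
      using that by (auto simp: P)
    moreover have "Min (range (\<lambda>i. x $ i)) \<le> x $ i" for i
      by (rule Min_le) auto
    ultimately show ?thesis
      by (intro exI[of _ "Min (range (\<lambda>i. x $ i))"]) (simp add: less_eq_vec_def e_def)
  qed
  define a where "a k = norm ((f ^^ k) e)" for k
  have apos: "a k > 0" for k
    using normpos[OF Pk[OF eP]] by (simp add: a_def)
  have upk: "norm ((f ^^ k) x) \<le> norm x * a k" if "x \<in> P" for x k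
  proof -
    have "(f ^^ k) x \<le> norm x *\<^sub>R (f ^^ k) e"
      using monok[OF that Ps[OF eP normpos[OF that]] upper] homk[OF eP normpos[OF that]] by simp
    from normle[OF Pk[OF that] this] show ?thesis by (simp add: a_def)
  qed
  have lowk: "c * a k \<le> norm ((f ^^ k) x)" if "x \<in> P" "c > 0" "c *\<^sub>R e \<le> x" for x c k
  proof -
    have "c *\<^sub>R (f ^^ k) e \<le> (f ^^ k) x"
      using monok[OF Ps[OF eP that(2)] that(1,3)] homk[OF eP that(2)] by simp
    from normle[OF Ps[OF Pk[OF eP] that(2)] this] show ?thesis
      using that(2) by (simp add: a_def)
  qed
  have sub: "a (k + m) \<le> a k * a m" for k m
    using upk[OF Pk[OF eP], of k m] by (simp add: a_def funpow_add mult.commute)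
  obtain c where c: "c > 0" "c *\<^sub>R e \<le> f e"
    using lower[OF Pf[OF eP]] by blast
  have low: "c ^ k * a 0 \<le> a k" for k
  proof (induction k)
    case (Suc k)
    have "c * a k \<le> a (Suc k)"
      using lowk[OF Pf[OF eP] c, of k] by (simp add: a_def funpow_swap1)
    moreover have "c * (c ^ k * a 0) \<le> c * a k"
      using Suc c by simp
    ultimately show ?case by (simp add: mult.assoc)
  qed simp
  have "1 \<le> a 0"
    using component_le_norm_cart[of e undefined] by (simp add: a_def e_def)
  with low have low': "c ^ k \<le> a k" for k
    using order_trans[OF mult_left_mono[of 1 "a 0" "c ^ k"] low[of k]] c by simp
  have "\<exists>L. (\<lambda>k. ln (a k) / real k) \<longlonglongrightarrow> L"
  proof (rule subadditive_quotient_tendsto)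
    show "ln (a (k + m)) \<le> ln (a k) + ln (a m)" for k m
    proof -
      have "ln (a (k + m)) \<le> ln (a k * a m)"
        using sub[of k m] apos by (subst ln_le_cancel_iff) auto
      then show ?thesis using apos[of k] apos[of m] by (simp add: ln_mult)
    qed
    show "ln c * real k \<le> ln (a k)" for k
    proof -
      have "ln (c ^ k) \<le> ln (a k)"
        using low'[of k] apos c by (subst ln_le_cancel_iff) auto
      then show ?thesis using c by (simp add: ln_realpow mult.commute)
    qed
  qed
  then obtain L where L: "(\<lambda>k. ln (a k) / real k) \<longlonglongrightarrow> L" by blast
  have roota: "(\<lambda>k. root k (a k)) \<longlonglongrightarrow> exp L"
  proof (rule Lim_transform_eventually[OF tendsto_exp[OF L]])
    show "\<forall>\<^sub>F k in sequentially. exp (ln (a k) / real k) = root k (a k)"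
      using eventually_gt_at_top[of 0]
    proof eventually_elim
      case (elim k)
      have "ln (root k (a k)) = ln (a k) / real k"
        using elim apos[of k] by (simp add: ln_root)
      then show ?case
        using elim apos[of k] by (metis exp_ln real_root_gt_zero)
    qed
  qed
  have "(\<lambda>k. root k (norm ((f ^^ k) x))) \<longlonglongrightarrow> exp L" if x: "x \<in> P" for x
  proof -
    obtain s where s: "s > 0" "s *\<^sub>R e \<le> x" using lower[OF x] by blast
    have lims: "(\<lambda>k. root k (t * a k)) \<longlonglongrightarrow> exp L" if "t > 0" for t
      using tendsto_mult[OF LIMSEQ_root_const[OF that] roota] by (simp add: real_root_mult)
    show ?thesis
    proof (rule tendsto_sandwich[OF _ _ lims[OF s(1)] lims[OF normpos[OF x]]])
      show "\<forall>\<^sub>F k in sequentially. root k (s * a k) \<le> root k (norm ((f ^^ k) x))"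
        using eventually_gt_at_top[of 0] by eventually_elim (use lowk[OF x s] in simp)
      show "\<forall>\<^sub>F k in sequentially. root k (norm ((f ^^ k) x)) \<le> root k (norm x * a k)"
        using eventually_gt_at_top[of 0] by eventually_elim (use upk[OF x] in simp)
    qed
  qed
  then show ?thesis unfolding P_def[symmetric] by (intro exI[of _ "exp L"]) simp
qed

lemma tendsto_cone_spectral_radius:
  fixes f :: "real ^ 'n \<Rightarrow> real ^ 'n"
  assumes "f \<in> interior nonneg_orthant \<rightarrow> interior nonneg_orthant"
    and "mono_on (interior nonneg_orthant) f"
    and "homogeneous_on (interior nonneg_orthant) f"
  shows "0 < cone_spectral_radius f"
    and "x \<in> interior nonneg_orthant \<Longrightarrow>
           (\<lambda>k. root k (norm ((f ^^ k) x))) \<longlonglongrightarrow> cone_spectral_radius f"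
proof -
  obtain r where r: "r > 0"
    "\<forall>x\<in>interior nonneg_orthant. (\<lambda>k. root k (norm ((f ^^ k) x))) \<longlonglongrightarrow> r"
    using cone_spectral_radius_wf[OF assms] by blast
  have "(\<chi> i. 1) \<in> interior (nonneg_orthant :: (real ^ 'n) set)"
    by (simp add: interior_nonneg_orthant)
  then have "cone_spectral_radius f = r"
    unfolding cone_spectral_radius_def using r(2)
    by (intro the_equality) (auto intro: LIMSEQ_unique)
  with r show "0 < cone_spectral_radius f"
    and "x \<in> interior nonneg_orthant \<Longrightarrow>
           (\<lambda>k. root k (norm ((f ^^ k) x))) \<longlonglongrightarrow> cone_spectral_radius f"
    by auto
qed

end

theory Submission
  imports Defs
begin

text \<open>
  The extension sends \<open>x\<close> to the componentwise supremum of \<open>f w\<close> over all finite positive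
  \<open>w \<le> x\<close>. It inherits monotonicity and homogeneity from \<open>f\<close>. Together with its approximation
  from below by finite vectors, these force continuity: a neighbourhood of \<open>x\<close> lies below \<open>s x\<close> for any \<open>s > 1\<close>, and above \<open>t w\<close>
  for any \<open>t < 1\<close> and any finite \<open>w \<le> x\<close> (\<open>ext_continuous\<close>).

  For the eigenvector, pass to reciprocals. The map \<open>g(x) = 1 / f(1 / x)\<close> is again order-preserving
  and homogeneous, and points with infinite entries become boundary points of the orthant, so the
  task is to find an eigenvector of \<open>g\<close> in the closed simplex whose eigenvalue is at least
  \<open>1 / \<rho>\<close>. Pushing the normalised map \<open>g(x) / |g(x)|\<close> slightly towards the interior gives a
  continuous self-map of a compact convex set of positive vectors. Its Brouwer fixed point
  satisfies \<open>g(x) = r (x - \<eta>)\<close>, with \<open>\<eta>\<close> subtracted from each entry (\<open>approximate_eigenvector\<close>).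
  In particular \<open>g(x) \<le> r x\<close>, that is \<open>f(y) \<ge> y / r\<close> for \<open>y = 1 / x\<close>; iterating this inequality
  yields \<open>1 / r \<le> \<rho>\<close> (\<open>approximate_eigenvalue_bound\<close>). This uniform lower bound on \<open>r\<close> is what
  prevents the eigenvalue from degenerating to zero in the limit.

  As \<open>\<eta> \<rightarrow> 0\<close>, a subsequence of the fixed points converges to some \<open>u\<close> in the simplex. Then
  \<open>z = 1 / u\<close> has a finite entry because \<open>u \<noteq> 0\<close>, and continuity of the extension turns the
  approximate equation into the exact eigenvector equation (\<open>ext_eigenvector\<close>). Monotonicity
  of the extension gives the remaining claim about the vectors below \<open>z\<close>.
\<close>

section \<open>The extension of an order-preserving homogeneous map\<close>

lemma inverse_inverse_ennreal: "inverse (inverse x) = (x :: ennreal)"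
proof (cases "x = 0 \<or> x = top")
  case False
  then obtain r where "x = ennreal r" "0 < r"
    by (cases x) (auto simp: less_le)
  then show ?thesis
    by (simp add: inverse_ennreal)
qed auto

lemma eventually_component_at_within:
  fixes x :: "'a :: topological_space ^ 'n"
  assumes "\<And>i. \<forall>\<^sub>F t in nhds (x $ i). P i t"
  shows "\<forall>\<^sub>F y in at x within S. \<forall>i. P i (y $ i)"
proof (rule eventually_all_finite)
  fix i
  have "((\<lambda>y. y $ i) \<longlongrightarrow> x $ i) (at x within S)"
    by (intro tendsto_intros)
  with assms[of i] show "\<forall>\<^sub>F y in at x within S. P i (y $ i)"
    by (simp add: filterlim_iff)
qed

locale homogeneous_orthant_map =
  fixes f :: "real ^ 'n \<Rightarrow> real ^ 'n"
  assumes maps: "f \<in> interior nonneg_orthant \<rightarrow> interior nonneg_orthant"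
    and mono: "mono_on (interior nonneg_orthant) f"
    and homogeneous: "homogeneous_on (interior nonneg_orthant) f"
begin

lemma pos_image: "(\<And>i. 0 < x $ i) \<Longrightarrow> 0 < f x $ j"
  using maps by (auto simp: interior_nonneg_orthant Pi_iff)

lemma scale: "(\<And>i. 0 < x $ i) \<Longrightarrow> 0 < c \<Longrightarrow> f (c *\<^sub>R x) = c *\<^sub>R f x"
  using homogeneous by (simp add: homogeneous_on_def interior_nonneg_orthant)

lemma mono_component:
  assumes "\<And>i. 0 < x $ i" "\<And>i. x $ i \<le> y $ i"
  shows "f x $ j \<le> f y $ j"
proof -
  have "0 < y $ i" for i
    using assms[of i] by linarith
  then have "f x \<le> f y"
    using assms by (intro mono_onD[OF mono]) (auto simp: interior_nonneg_orthant less_eq_vec_def)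
  then show ?thesis
    by (simp add: less_eq_vec_def)
qed

text \<open>
  Taking the supremum over all finite vectors below \<open>x\<close>, rather than a limit along truncations
  of \<open>x\<close>, makes monotonicity immediate and treats finite and infinite entries uniformly.
\<close>

definition ext :: "ennreal ^ 'n \<Rightarrow> ennreal ^ 'n" where
  "ext x = (\<chi> i. SUP w \<in> {w \<in> interior nonneg_orthant. to_ext w \<le> x}. ennreal (f w $ i))"

lemma ext_lower:
  assumes "\<And>i. 0 < w $ i" "to_ext w \<le> x"
  shows "ennreal (f w $ j) \<le> ext x $ j"
  unfolding ext_def using assms by (auto simp: interior_nonneg_orthant intro!: SUP_upper)

lemma ext_upper:
  assumes "\<And>w. (\<And>i. 0 < w $ i) \<Longrightarrow> to_ext w \<le> x \<Longrightarrow> ennreal (f w $ j) \<le> b"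
  shows "ext x $ j \<le> b"
  unfolding ext_def using assms by (auto simp: interior_nonneg_orthant intro!: SUP_least)

lemma ext_to_ext:
  assumes "\<And>i. 0 < x $ i"
  shows "ext (to_ext x) = to_ext (f x)"
proof -
  have "ext (to_ext x) $ j = ennreal (f x $ j)" for j
  proof (rule antisym)
    show "ext (to_ext x) $ j \<le> ennreal (f x $ j)"
    proof (rule ext_upper)
      fix w :: "real ^ 'n" assume w: "\<And>i. 0 < w $ i" "to_ext w \<le> to_ext x"
      have "w $ i \<le> x $ i" for i
        using w(2) less_imp_le[OF assms] by (simp add: to_ext_def less_eq_vec_def ennreal_le_iff)
      then show "ennreal (f w $ j) \<le> ennreal (f x $ j)"
        using w by (intro ennreal_leI mono_component)
    qed
  qed (use assms in \<open>auto intro!: ext_lower\<close>)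
  then show ?thesis
    by (simp add: vec_eq_iff to_ext_def)
qed

lemma ext_mono: "x \<le> y \<Longrightarrow> ext x \<le> ext y"
  by (auto simp: less_eq_vec_def intro!: ext_upper ext_lower intro: order_trans)

lemma ext_in:
  assumes "x \<in> ext_pos_orthant"
  shows "ext x \<in> ext_pos_orthant"
proof -
  define w :: "real ^ 'n" where "w = (\<chi> i. enn2real (min 1 (x $ i)))"
  have fin: "min 1 (x $ i) < top" for i
    by (metis ennreal_one_less_top min_less_iff_disj)
  have w: "0 < w $ i" for i
    using assms fin[of i] by (simp add: w_def enn2real_positive_iff ext_pos_orthant_def)
  have "to_ext w \<le> x"
    using fin by (simp add: w_def to_ext_def less_eq_vec_def)
  then have "ennreal (f w $ j) \<le> ext x $ j" for j
    by (rule ext_lower[OF w])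
  moreover have "0 < ennreal (f w $ j)" for j
    using pos_image[OF w] by simp
  ultimately show ?thesis
    unfolding ext_pos_orthant_def by (blast intro: order.strict_trans2)
qed

text \<open>
  Rescaling the finite vectors below \<open>c x\<close> by \<open>1 / c\<close> turns them into the finite vectors
  below \<open>x\<close>.
\<close>

lemma ext_scale_le:
  assumes "0 < c"
  shows "ext (ennreal c *s x) $ j \<le> ennreal c * ext x $ j"
proof (rule ext_upper)
  fix w :: "real ^ 'n" assume w: "\<And>i. 0 < w $ i" "to_ext w \<le> ennreal c *s x"
  define v where "v = inverse c *\<^sub>R w"
  have v: "0 < v $ i" for i
    using w(1) assms by (simp add: v_def)
  have "to_ext v \<le> x"
    unfolding less_eq_vec_def
  proof
    fix i
    have "ennreal c * ennreal (v $ i) = ennreal (w $ i)"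
      using assms w(1)[of i] by (subst ennreal_mult[symmetric]) (auto simp: v_def less_imp_le)
    also have "\<dots> \<le> ennreal c * x $ i"
      using w(2) by (simp add: less_eq_vec_def to_ext_def)
    finally show "to_ext v $ i \<le> x $ i"
      using assms by (subst (asm) ennreal_mult_le_mult_iff) (auto simp: to_ext_def)
  qed
  have "f w = c *\<^sub>R f v"
    using assms scale[OF v assms] by (simp add: v_def)
  then have "ennreal (f w $ j) = ennreal c * ennreal (f v $ j)"
    using assms pos_image[OF v, of j] by (simp add: ennreal_mult less_imp_le)
  also have "\<dots> \<le> ennreal c * ext x $ j"
    by (intro mult_left_mono ext_lower v \<open>to_ext v \<le> x\<close>) simp
  finally show "ennreal (f w $ j) \<le> ennreal c * ext x $ j" .
qed

text \<open>
  Each component is semicontinuous from both sides. From below, if \<open>f w\<close> with \<open>w \<le> x\<close> exceeds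
  a bound in some component, so does \<open>t f(w) = f(t w)\<close> for some \<open>t < 1\<close>, and \<open>t w\<close> is strictly
  below \<open>x\<close> in every entry and hence below all nearby points. From above, all points near \<open>x\<close>
  are below \<open>s x\<close> when \<open>s > 1\<close>, including at infinite entries, which \<open>s\<close> does not change; there
  the extension is at most \<open>s\<close> times its value at \<open>x\<close>.
\<close>

lemma ext_continuous: "continuous_on ext_pos_orthant ext"
  unfolding continuous_on_def
proof (intro ballI vec_tendstoI order_tendstoI)
  fix x :: "ennreal ^ 'n" and j :: 'n and a :: ennreal
  assume x: "x \<in> ext_pos_orthant"
  {
    assume "a < ext x $ j"
    then obtain w where w: "\<And>i. 0 < w $ i" "to_ext w \<le> x" and a: "a < ennreal (f w $ j)"
      by (auto simp: ext_def less_SUP_iff interior_nonneg_orthant)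
    obtain b where b: "a = ennreal b" "0 \<le> b" "b < f w $ j"
      using a by (cases a) (auto simp: ennreal_less_iff)
    obtain c where c: "b < c" "c < f w $ j"
      using b dense by blast
    define t where "t = c / f w $ j"
    have fw: "0 < f w $ j"
      by (rule pos_image[OF w(1)])
    have t: "0 < t" "t < 1" and tc: "t * f w $ j = c"
      using b c fw by (auto simp: t_def)
    have tw: "0 < (t *\<^sub>R w) $ i" for i
      using t w(1) by simp
    have "ennreal ((t *\<^sub>R w) $ i) < x $ i" for i
    proof -
      have "(t *\<^sub>R w) $ i < w $ i"
        using t w(1)[of i] by simp
      then have "ennreal ((t *\<^sub>R w) $ i) < ennreal (w $ i)"
        using w(1)[of i] by (intro ennreal_lessI)
      also have "\<dots> \<le> x $ i"
        using w(2) by (simp add: to_ext_def less_eq_vec_def)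
      finally show ?thesis .
    qed
    then have "\<forall>\<^sub>F y in at x within ext_pos_orthant. \<forall>i. ennreal ((t *\<^sub>R w) $ i) < y $ i"
      by (intro eventually_component_at_within order_tendstoD(1)[OF filterlim_ident])
    then show "\<forall>\<^sub>F y in at x within ext_pos_orthant. a < ext y $ j"
    proof eventually_elim
      case (elim y)
      have "a < ennreal (f (t *\<^sub>R w) $ j)"
        using b c tc by (simp add: scale[OF w(1) t(1)] ennreal_lessI)
      also have "\<dots> \<le> ext y $ j"
        using elim by (intro ext_lower tw) (auto simp: to_ext_def less_eq_vec_def less_imp_le)
      finally show ?case .
    qed
  }
  {
    assume a: "ext x $ j < a"
    have pos: "0 < ext x $ j"
      using ext_in[OF x] by (simp add: ext_pos_orthant_def)
    obtain m where m: "ext x $ j < m" "m < a"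
      using a dense by blast
    obtain b where b: "m = ennreal b" "0 \<le> b"
      using m by (cases m) auto
    obtain c where c: "ext x $ j = ennreal c" "0 < c" "c < b"
      using m b pos by (cases "ext x $ j") (auto simp: ennreal_less_iff)
    define s where "s = b / c"
    have s: "1 < s" "s * c = b"
      using c by (auto simp: s_def)
    have nhd: "\<forall>\<^sub>F t in nhds (x $ i). t \<le> ennreal s * x $ i" for i
    proof (cases "x $ i")
      case (real r)
      have "0 < r"
      proof -
        have "0 < x $ i"
          using x by (simp add: ext_pos_orthant_def)
        then show ?thesis
          by (simp add: real(2))
      qed
      then have "x $ i < ennreal s * x $ i"
        using s real by (simp add: ennreal_less_iff flip: ennreal_mult)
      then have "\<forall>\<^sub>F t in nhds (x $ i). t < ennreal s * x $ i"
        by (intro order_tendstoD(2)[OF filterlim_ident])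
      then show ?thesis
        by eventually_elim simp
    next
      case top
      then show ?thesis
        using s by (simp add: ennreal_mult_top)
    qed
    have "\<forall>\<^sub>F y in at x within ext_pos_orthant. \<forall>i. y $ i \<le> ennreal s * x $ i"
      by (intro eventually_component_at_within nhd)
    then show "\<forall>\<^sub>F y in at x within ext_pos_orthant. ext y $ j < a"
    proof eventually_elim
      case (elim y)
      then have "ext y $ j \<le> ext (ennreal s *s x) $ j"
        using ext_mono[of y "ennreal s *s x"] by (simp add: less_eq_vec_def)
      also have "\<dots> \<le> ennreal s * ext x $ j"
        using s by (intro ext_scale_le) simp
      also have "\<dots> = m"
        using s c b by (simp flip: ennreal_mult)
      also note m(2)
      finally show ?case .
    qed
  }
qed

text \<open>
  The extension is continuous, and \<open>f\<close> is its restriction to finite vectors.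
\<close>

lemma continuous_component:
  "continuous_on (interior nonneg_orthant) (\<lambda>x. f x $ j)"
proof -
  have "continuous_on (interior nonneg_orthant) (\<lambda>x. ext (to_ext x) $ j)"
  proof -
    have "continuous_on (interior nonneg_orthant) (to_ext :: real ^ 'n \<Rightarrow> _)"
      unfolding to_ext_def continuous_on_def by (auto intro!: vec_tendstoI tendsto_intros)
    then have "continuous_on (interior nonneg_orthant) (\<lambda>x. ext (to_ext x))"
      by (rule continuous_on_compose2[OF ext_continuous])
        (auto simp: to_ext_def ext_pos_orthant_def interior_nonneg_orthant)
    then show ?thesis
      unfolding continuous_on_def by (auto intro: tendsto_vec_nth)
  qed
  then have "continuous_on (interior nonneg_orthant) (\<lambda>x. ennreal (f x $ j))"
    by (rule continuous_on_eq) (auto simp: interior_nonneg_orthant ext_to_ext, simp add: to_ext_def)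
  then have "continuous_on (interior nonneg_orthant) (\<lambda>x. enn2real (ennreal (f x $ j)))"
    unfolding continuous_on_def by (auto intro!: tendsto_enn2real)
  then show ?thesis
    by (rule continuous_on_eq) (auto simp: interior_nonneg_orthant pos_image less_imp_le)
qed

section \<open>Lower bounds on the spectral radius\<close>

text \<open>
  Iterating \<open>c y \<le> f(y)\<close> gives \<open>c\<^sup>k y \<le> f\<^sup>k(y)\<close>; compare \<open>k\<close>-th roots of norms.
\<close>

lemma le_cone_spectral_radius:
  assumes y: "\<And>i. 0 < y $ i" and c: "0 < c" and sub: "\<And>i. c * y $ i \<le> f y $ i"
  shows "c \<le> cone_spectral_radius f"
proof -
  have iter: "0 < (f ^^ k) y $ i \<and> c ^ k * y $ i \<le> (f ^^ k) y $ i" for k i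
  proof (induction k arbitrary: i)
    case (Suc k)
    have pos: "0 < (c ^ k *\<^sub>R y) $ i" for i
      using c y by simp
    have "c ^ Suc k * y $ i \<le> c ^ k * f y $ i"
      using sub[of i] c by (simp add: mult.assoc mult.left_commute)
    also have "\<dots> = f (c ^ k *\<^sub>R y) $ i"
      using scale[OF y, of "c ^ k"] c by simp
    also have "\<dots> \<le> f ((f ^^ k) y) $ i"
      using Suc pos by (intro mono_component) auto
    finally show ?case
      using Suc by (auto intro!: pos_image)
  qed (use y in auto)
  have ny: "0 < norm y"
    using y by (metis less_irrefl zero_index zero_less_norm_iff)
  have "c * root k (norm y) \<le> root k (norm ((f ^^ k) y))" if "0 < k" for k
  proof -
    have "norm (c ^ k *\<^sub>R y) \<le> norm ((f ^^ k) y)"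
      using iter y c by (intro norm_le_componentwise_cart) (simp add: abs_mult less_imp_le)
    then have "root k (c ^ k * norm y) \<le> root k (norm ((f ^^ k) y))"
      using that c by simp
    then show ?thesis
      using that c by (simp add: real_root_mult real_root_power_cancel)
  qed
  then have ev: "\<forall>\<^sub>F k in sequentially. c * root k (norm y) \<le> root k (norm ((f ^^ k) y))"
    by (intro eventually_mono[OF eventually_gt_at_top[of 0]])
  have "(\<lambda>k. c * root k (norm y)) \<longlonglongrightarrow> c * 1"
    by (intro tendsto_intros LIMSEQ_root_const ny)
  moreover have "(\<lambda>k. root k (norm ((f ^^ k) y))) \<longlonglongrightarrow> cone_spectral_radius f"
    by (rule tendsto_cone_spectral_radius(2)[OF maps mono homogeneous])
      (use y in \<open>simp add: interior_nonneg_orthant\<close>)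
  ultimately show ?thesis
    using tendsto_le[OF sequentially_bot _ _ ev] by simp
qed

section \<open>Approximate eigenvectors in reciprocal coordinates\<close>

text \<open>
  This is an eigenvector equation for \<open>g(x) = 1 / f(1 / x)\<close>, up to the shift by \<open>\<eta>\<close>. The vector is
  a fixed point of \<open>x \<mapsto> (1 - n \<eta>) g(x) / |g(x)| + \<eta>\<close>, where \<open>|\<cdot>|\<close> is the sum of the entries. This
  map preserves the part of the unit simplex in which all entries are at least \<open>\<eta>\<close>. As that part
  stays away from the boundary, continuity of \<open>f\<close> on positive vectors suffices.
\<close>

lemma approximate_eigenvector:
  assumes \<eta>: "0 < \<eta>" "real CARD('n) * \<eta> < 1"
  obtains x :: "real ^ 'n" and r where
    "\<And>i. 0 < x $ i" "(\<Sum>i\<in>UNIV. x $ i) = 1" "0 < r"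
    "\<And>i. inverse (f (\<chi> i. inverse (x $ i)) $ i) = r * (x $ i - \<eta>)"
proof -
  define \<theta> where "\<theta> = 1 - real CARD('n) * \<eta>"
  have \<theta>: "0 < \<theta>"
    using \<eta> by (simp add: \<theta>_def)
  define K where "K = {x :: real ^ 'n. (\<Sum>i\<in>UNIV. x $ i) = 1 \<and> (\<forall>i. \<eta> \<le> x $ i)}"
  have Kpos: "0 < x $ i" if "x \<in> K" for x i
    using that \<eta>(1) unfolding K_def by (auto intro: order.strict_trans2)
  define rec :: "real ^ 'n \<Rightarrow> real ^ 'n" where "rec x = (\<chi> i. inverse (x $ i))" for x
  define g where "g x i = inverse (f (rec x) $ i)" for x i
  have gpos: "0 < g x i" if "x \<in> K" for x i
    using Kpos[OF that] by (simp add: g_def rec_def pos_image)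
  define s where "s x = (\<Sum>i\<in>UNIV. g x i)" for x
  have spos: "0 < s x" if "x \<in> K" for x
    using gpos[OF that] by (auto simp: s_def intro!: sum_pos)
  define h :: "real ^ 'n \<Rightarrow> real ^ 'n" where "h x = (\<chi> i. \<theta> * (g x i / s x) + \<eta>)" for x
  have "compact K"
  proof -
    have "closed {x :: real ^ 'n. (\<Sum>i\<in>UNIV. x $ i) = 1}"
      by (intro closed_Collect_eq continuous_intros)
    moreover have "closed {x :: real ^ 'n. \<forall>i. \<eta> \<le> x $ i}"
      by (intro closed_Collect_all closed_Collect_le continuous_intros)
    ultimately have "closed K"
      unfolding K_def by (rule closed_Collect_conj)
    moreover have "norm x \<le> 1" if "x \<in> K" for x
    proof -
      have "norm x \<le> (\<Sum>i\<in>UNIV. \<bar>x $ i\<bar>)"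
        by (rule norm_le_l1_cart)
      also have "\<dots> = (\<Sum>i\<in>UNIV. x $ i)"
        using Kpos[OF that] by (intro sum.cong) (auto simp: less_imp_le)
      finally show ?thesis
        using that by (simp add: K_def)
    qed
    then have "bounded K"
      by (auto simp: bounded_iff)
    ultimately show ?thesis
      by (simp add: compact_eq_bounded_closed)
  qed
  moreover have "convex K"
  proof (rule convexI)
    fix x y :: "real ^ 'n" and u v :: real
    assume xy: "x \<in> K" "y \<in> K" and uv: "0 \<le> u" "0 \<le> v" "u + v = 1"
    have "(\<Sum>i\<in>UNIV. u * x $ i + v * y $ i) = u * (\<Sum>i\<in>UNIV. x $ i) + v * (\<Sum>i\<in>UNIV. y $ i)"
      by (simp add: sum.distrib sum_distrib_left)
    then have "(\<Sum>i\<in>UNIV. u * x $ i + v * y $ i) = 1"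
      using xy uv by (simp add: K_def)
    moreover have "\<eta> \<le> u * x $ i + v * y $ i" for i
    proof -
      have "u * \<eta> + v * \<eta> \<le> u * x $ i + v * y $ i"
        using xy uv by (intro add_mono mult_left_mono) (auto simp: K_def)
      then show ?thesis
        using uv by (simp flip: distrib_right)
    qed
    ultimately show "u *\<^sub>R x + v *\<^sub>R y \<in> K"
      by (simp add: K_def)
  qed
  moreover have "(\<chi> i. 1 / real CARD('n)) \<in> K"
    using \<eta> by (simp add: K_def field_simps)
  then have "K \<noteq> {}"
    by blast
  moreover have "continuous_on K h"
  proof -
    have "continuous_on K rec"
      unfolding rec_def by (intro continuous_intros) (metis Kpos less_irrefl)
    moreover have "rec ` K \<subseteq> interior nonneg_orthant"
      using Kpos by (auto simp: rec_def interior_nonneg_orthant)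
    ultimately have fc: "continuous_on K (\<lambda>x. f (rec x) $ i)" for i
      by (rule continuous_on_compose2[OF continuous_component])
    have g: "continuous_on K (\<lambda>x. g x i)" for i
    proof -
      have "f (rec x) $ i \<noteq> 0" if "x \<in> K" for x
        using gpos[OF that, of i] by (auto simp: g_def)
      then show ?thesis
        unfolding g_def by (intro continuous_on_inverse fc) blast
    qed
    then have "continuous_on K s"
      unfolding s_def by (intro continuous_intros)
    with g show ?thesis
      unfolding h_def using spos by (intro continuous_intros) (auto simp: less_imp_neq[symmetric])
  qed
  moreover have "h \<in> K \<rightarrow> K"
  proof
    fix x assume x: "x \<in> K"
    have "(\<Sum>i\<in>UNIV. h x $ i) = \<theta> * ((\<Sum>i\<in>UNIV. g x i) / s x) + real CARD('n) * \<eta>"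
      by (simp add: h_def sum.distrib sum_distrib_left sum_divide_distrib)
    also have "\<dots> = 1"
      using spos[OF x] by (simp add: \<theta>_def flip: s_def)
    finally show "h x \<in> K"
      using gpos[OF x] spos[OF x] \<theta> by (auto simp: K_def h_def less_imp_le)
  qed
  ultimately obtain x where x: "x \<in> K" "h x = x"
    using brouwer by blast
  show ?thesis
  proof
    show "0 < x $ i" for i
      by (rule Kpos[OF x(1)])
    show "(\<Sum>i\<in>UNIV. x $ i) = 1"
      using x by (simp add: K_def)
    show "0 < s x / \<theta>"
      using spos[OF x(1)] \<theta> by simp
    show "inverse (f (\<chi> i. inverse (x $ i)) $ i) = s x / \<theta> * (x $ i - \<eta>)" for i
    proof -
      have "x $ i = \<theta> * (g x i / s x) + \<eta>"
        by (subst (1) x(2)[symmetric]) (simp add: h_def)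
      then have "g x i = s x / \<theta> * (x $ i - \<eta>)"
        using spos[OF x(1)] \<theta> by (simp add: field_simps)
      then show ?thesis
        by (simp add: g_def rec_def)
    qed
  qed
qed

text \<open>
  The shift by \<open>\<eta>\<close> has a favourable sign: for \<open>y = 1 / x\<close> it leaves the inequality
  \<open>f(y) \<ge> y / r\<close>.
\<close>

lemma approximate_eigenvalue_bound:
  assumes x: "\<And>i. 0 < x $ i" and r: "0 < r" and "0 \<le> \<eta>"
    and eq: "\<And>i. inverse (f (\<chi> i. inverse (x $ i)) $ i) = r * (x $ i - \<eta>)"
  shows "inverse r \<le> cone_spectral_radius f"
proof (rule le_cone_spectral_radius)
  define y :: "real ^ 'n" where "y = (\<chi> i. inverse (x $ i))"
  show y: "0 < y $ i" for i
    using x by (simp add: y_def)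
  show "0 < inverse r"
    using r by simp
  show "inverse r * y $ i \<le> f y $ i" for i
  proof -
    have "inverse (f y $ i) \<le> r * x $ i"
      unfolding y_def eq using r \<open>0 \<le> \<eta>\<close> by (intro mult_left_mono) auto
    then have "inverse (r * x $ i) \<le> inverse (inverse (f y $ i))"
      using pos_image[OF y, of i] by (intro le_imp_inverse_le) auto
    then show ?thesis
      by (simp add: y_def)
  qed
qed

section \<open>An eigenvector of the extension\<close>

text \<open>
  The approximate eigenvectors are normalised in reciprocal coordinates, where the simplex is
  compact. A limit may have zero entries, which become the infinite entries of \<open>z\<close>, but its
  entries still sum to one, so at least one entry of \<open>z\<close> is finite.
\<close>

lemma ext_eigenvector:
  obtains z c where "z \<in> ext_pos_orthant" "\<exists>i. z $ i \<noteq> \<infinity>"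
    "0 < c" "c \<le> cone_spectral_radius f" "ext z = ennreal c *s z"
proof -
  define n where "n = real CARD('n)"
  \<comment> \<open>The shift must stay below \<open>1 / n\<close> for all \<open>m\<close>, hence the double successor.\<close>
  define \<eta> where "\<eta> m = inverse n * inverse (real (Suc (Suc m)))" for m
  have n: "0 < n"
    by (simp add: n_def)
  have \<eta>: "0 < \<eta> m" "n * \<eta> m < 1" for m
  proof -
    show "0 < \<eta> m"
      using n by (simp add: \<eta>_def)
    have "n * \<eta> m = inverse (real (Suc (Suc m)))"
      using n by (simp add: \<eta>_def)
    then show "n * \<eta> m < 1"
      by (simp add: inverse_less_1_iff)
  qed
  have "(\<lambda>m. inverse (real (Suc (Suc m)))) \<longlonglongrightarrow> 0"
    using LIMSEQ_Suc[OF LIMSEQ_inverse_real_of_nat] .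
  then have \<eta>0: "\<eta> \<longlonglongrightarrow> 0"
    unfolding \<eta>_def by (rule tendsto_mult_right_zero)
  define \<rho> where "\<rho> = cone_spectral_radius f"
  have \<rho>: "0 < \<rho>"
    unfolding \<rho>_def by (rule tendsto_cone_spectral_radius(1)[OF maps mono homogeneous])
  have "\<exists>x r. (\<forall>i. 0 < x $ i) \<and> (\<Sum>i\<in>UNIV. x $ i) = 1 \<and> 0 < r \<and>
      (\<forall>i. inverse (f (\<chi> i. inverse (x $ i)) $ i) = r * (x $ i - \<eta> m))" for m
    using approximate_eigenvector[of "\<eta> m"] \<eta>[of m] unfolding n_def by metis
  then obtain x r where x: "\<And>m i. 0 < x m $ i" and x1: "\<And>m. (\<Sum>i\<in>UNIV. x m $ i) = 1"
    and r: "\<And>m. 0 < r m"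
    and eq: "\<And>m i. inverse (f (\<chi> i. inverse (x m $ i)) $ i) = r m * (x m $ i - \<eta> m)"
    by metis
  have "bounded (range x)"
  proof -
    have "norm (x m) \<le> 1" for m
      using norm_le_l1_cart[of "x m"] x[of m] x1[of m] by (simp add: abs_of_pos)
    then show ?thesis
      by (auto simp: bounded_iff)
  qed
  then obtain u \<phi> where \<phi>: "strict_mono \<phi>" and u: "(x \<circ> \<phi>) \<longlonglongrightarrow> u"
    using bounded_imp_convergent_subsequence by blast
  have ui: "(\<lambda>m. x (\<phi> m) $ i) \<longlonglongrightarrow> u $ i" for i
    using tendsto_vec_nth[OF u] by (simp add: o_def)
  have u0: "0 \<le> u $ i" for i
    using ui[of i] by (rule LIMSEQ_le_const) (auto simp: less_imp_le x)
  have "(\<lambda>m. \<Sum>i\<in>UNIV. x (\<phi> m) $ i) \<longlonglongrightarrow> (\<Sum>i\<in>UNIV. u $ i)"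
    by (intro tendsto_intros ui)
  then have u1: "(\<Sum>i\<in>UNIV. u $ i) = 1"
    by (simp add: x1 LIMSEQ_const_iff)
  define z :: "ennreal ^ 'n" where "z = (\<chi> i. inverse (ennreal (u $ i)))"
  have z: "z \<in> ext_pos_orthant"
    by (simp add: z_def ext_pos_orthant_def ennreal_inverse_positive)
  define y :: "nat \<Rightarrow> real ^ 'n" where "y m = (\<chi> i. inverse (x (\<phi> m) $ i))" for m
  have y: "0 < y m $ i" for m i
    by (simp add: y_def x)
  have inverse_cont: "continuous_on UNIV (inverse :: ennreal \<Rightarrow> ennreal)"
    by (intro continuous_intros)
  have inverse_lim: "(\<lambda>m. inverse (a m)) \<longlonglongrightarrow> inverse l" if "a \<longlonglongrightarrow> l"
    for a :: "nat \<Rightarrow> ennreal" and l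
    using continuous_on_tendsto_compose[OF inverse_cont that] by simp
  have "(\<lambda>m. to_ext (y m)) \<longlonglongrightarrow> z"
  proof (rule vec_tendstoI)
    fix i
    have "(\<lambda>m. inverse (ennreal (x (\<phi> m) $ i))) \<longlonglongrightarrow> inverse (ennreal (u $ i))"
      by (intro inverse_lim tendsto_intros ui)
    then show "(\<lambda>m. to_ext (y m) $ i) \<longlonglongrightarrow> z $ i"
      by (simp add: to_ext_def y_def z_def inverse_ennreal x)
  qed
  then have "(\<lambda>m. ext (to_ext (y m))) \<longlonglongrightarrow> ext z"
    by (rule continuous_on_tendsto_compose[OF ext_continuous])
      (use z y in \<open>auto simp: ext_pos_orthant_def to_ext_def\<close>)
  then have fy: "(\<lambda>m. to_ext (f (y m))) \<longlonglongrightarrow> ext z"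
    by (simp add: ext_to_ext y)
  define v where "v i = enn2real (inverse (ext z $ i))" for i
  have v: "ennreal (v i) = inverse (ext z $ i)" for i
  proof -
    have "0 < ext z $ i"
      using ext_in[OF z] by (simp add: ext_pos_orthant_def)
    then have "inverse (ext z $ i) \<noteq> top"
      by simp
    then show ?thesis
      unfolding v_def by (simp only: ennreal_enn2real less_top)
  qed
  have vi: "(\<lambda>m. inverse (f (y m) $ i)) \<longlonglongrightarrow> v i" for i
  proof -
    have "(\<lambda>m. inverse (ennreal (f (y m) $ i))) \<longlonglongrightarrow> inverse (ext z $ i)"
      using inverse_lim[OF tendsto_vec_nth[OF fy]] by (simp add: to_ext_def)
    then have "(\<lambda>m. ennreal (inverse (f (y m) $ i))) \<longlonglongrightarrow> ennreal (v i)"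
      by (simp add: v inverse_ennreal pos_image y)
    then show ?thesis
      by (rule tendsto_ennrealD) (auto simp: v_def pos_image y less_imp_le)
  qed
  have gy: "inverse (f (y m) $ i) = r (\<phi> m) * (x (\<phi> m) $ i - \<eta> (\<phi> m))" for m i
    unfolding y_def by (rule eq)
  have \<eta>\<phi>: "(\<lambda>m. \<eta> (\<phi> m)) \<longlonglongrightarrow> 0"
    using LIMSEQ_subseq_LIMSEQ[OF \<eta>0 \<phi>] by (simp add: o_def)
  define S where "S = (\<Sum>i\<in>UNIV. v i)"
  \<comment> \<open>Summing the approximate equation over all entries expresses \<open>r\<close> through
      quantities that are already known to converge.\<close>
  have rS: "(\<lambda>m. r (\<phi> m)) \<longlonglongrightarrow> S"
  proof -
    have sum: "(\<Sum>i\<in>UNIV. inverse (f (y m) $ i)) = r (\<phi> m) * (1 - n * \<eta> (\<phi> m))" for m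
      by (simp add: gy sum_subtractf x1 n_def flip: sum_distrib_left)
    have "(\<lambda>m. (\<Sum>i\<in>UNIV. inverse (f (y m) $ i)) / (1 - n * \<eta> (\<phi> m))) \<longlonglongrightarrow> S / (1 - n * 0)"
      unfolding S_def by (intro tendsto_intros vi \<eta>\<phi>) auto
    moreover have "1 - n * \<eta> (\<phi> m) \<noteq> 0" for m
      using \<eta>(2)[of "\<phi> m"] by linarith
    ultimately show ?thesis
      by (simp add: sum)
  qed
  have "inverse \<rho> \<le> r m" for m
  proof -
    have "inverse (r m) \<le> \<rho>"
      unfolding \<rho>_def
      by (rule approximate_eigenvalue_bound[OF x r _ eq]) (use \<eta>(1)[of m] in simp)
    then have "inverse \<rho> \<le> inverse (inverse (r m))"
      using r[of m] by (intro le_imp_inverse_le) auto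
    then show ?thesis
      by simp
  qed
  \<comment> \<open>The limit eigenvalue inherits the bound, so the reciprocal eigenvalue is finite and at most
      the spectral radius.\<close>
  then have S\<rho>: "inverse \<rho> \<le> S"
    using rS by (intro LIMSEQ_le_const[OF rS]) auto
  moreover have "0 < inverse \<rho>"
    using \<rho> by simp
  ultimately have S: "0 < S"
    by linarith
  have vS: "v i = S * u $ i" for i
  proof -
    have "(\<lambda>m. r (\<phi> m) * (x (\<phi> m) $ i - \<eta> (\<phi> m))) \<longlonglongrightarrow> S * (u $ i - 0)"
      by (intro tendsto_intros rS ui \<eta>\<phi>)
    then show ?thesis
      using LIMSEQ_unique[OF vi[of i]] by (simp add: gy)
  qed
  have ez: "ext z = ennreal (inverse S) *s z"
  proof -
    have "ext z $ i = ennreal (inverse S) * z $ i" for i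
    proof -
      have "inverse (ext z $ i) = ennreal S * ennreal (u $ i)"
        using v[of i] S u0[of i] by (simp add: vS ennreal_mult)
      then have "ext z $ i = inverse (ennreal S * ennreal (u $ i))"
        by (metis inverse_inverse_ennreal)
      also have "\<dots> = inverse (ennreal S) * inverse (ennreal (u $ i))"
        by (intro ennreal_inverse_mult) auto
      finally show ?thesis
        using S by (simp add: z_def inverse_ennreal)
    qed
    then show ?thesis
      by (simp add: vec_eq_iff)
  qed
  show ?thesis
  proof
    show "\<exists>i. z $ i \<noteq> \<infinity>"
    proof (rule ccontr)
      assume "\<nexists>i. z $ i \<noteq> \<infinity>"
      then have "u $ i = 0" for i
        using u0[of i] by (intro antisym) (auto simp: z_def ennreal_eq_0_iff)
      with u1 show False
        by simp
    qed
    show "inverse S \<le> cone_spectral_radius f"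
      using le_imp_inverse_le[OF S\<rho>] \<rho> by (simp add: \<rho>_def)
    show "0 < inverse S"
      using S by simp
  qed (use z ez in auto)
qed

end

theorem theorem2:
  fixes f :: "real ^ 'n \<Rightarrow> real ^ 'n" and \<rho> :: real
  assumes "f \<in> interior nonneg_orthant \<rightarrow> interior nonneg_orthant"
    and "mono_on (interior nonneg_orthant) f"
    and "homogeneous_on (interior nonneg_orthant) f"
    and "\<rho> = cone_spectral_radius f"
  shows "\<exists>F :: ennreal ^ 'n \<Rightarrow> ennreal ^ 'n.
      F \<in> ext_pos_orthant \<rightarrow> ext_pos_orthant
    \<and> (\<forall>x\<in>interior nonneg_orthant. F (to_ext x) = to_ext (f x))
    \<and> continuous_on ext_pos_orthant F
    \<and> mono_on ext_pos_orthant F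
    \<and> (\<exists>z\<in>ext_pos_orthant. (\<exists>i. z $ i \<noteq> \<infinity>) \<and>
         (\<exists>\<rho>'::real. 0 < \<rho>' \<and> \<rho>' \<le> \<rho> \<and> F z = ennreal \<rho>' *s z) \<and>
         (\<forall>x\<in>ext_pos_orthant. x \<le> z \<longrightarrow> F x \<le> ennreal \<rho> *s z))"
proof -
  interpret homogeneous_orthant_map f
    by unfold_locales fact+
  obtain z c where z: "z \<in> ext_pos_orthant" "\<exists>i. z $ i \<noteq> \<infinity>"
    and c: "0 < c" "c \<le> \<rho>" and ez: "ext z = ennreal c *s z"
    using ext_eigenvector assms(4) by metis
  have "ext x \<le> ennreal \<rho> *s z" if "x \<le> z" for x
  proof -
    have "ext x \<le> ennreal c *s z"
      using ext_mono[OF that] ez by simp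
    also have "\<dots> \<le> ennreal \<rho> *s z"
      using c by (auto simp: less_eq_vec_def intro!: mult_right_mono ennreal_leI)
    finally show ?thesis .
  qed
  then show ?thesis
    using z c ez ext_in ext_to_ext ext_continuous ext_mono
    by (intro exI[of _ ext] conjI bexI[of _ z] exI[of _ c])
      (auto simp: interior_nonneg_orthant intro!: mono_onI)
qed

end
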